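(* Let $k \ge 2$, $m \ge 2$, and let $F = F_m \circ F_{m-1} \circ \cdots \circ F_1 : \mathbb{C}^k \to \mathbb{C}^k$, where $F_i(z_1,\dots,z_k) = (z_2,z_3,\dots,z_k,\alpha_i z_1 + p_i(z_k))$ with $p_i$ a polynomial of degree $d_i \ge 2$ and $\alpha_i \ne 0$ for $1 \le i \le m$. Let $d = d_1 d_2\cdots d_m$. For a given $0<\epsilon<1$, let the $2(k-1)$ constants $C_j(\pm\epsilon)$, $2 \le j \le k$, be defined by $$\log C_j(\pm \epsilon) = (1 + D^1_j + D^2_j + \cdots + D^{m-1}_j)\log(1 \pm \epsilon).$$ Then there exists $M > 0$ such that if $z = (z_1,\dots,z_k) \in K^-$, then for every $n \ge 0$ and every $2 \le j \le k$ $$|z_j^n| \le C_j(\epsilon)^{d^n} \max\{ |z_j^0|^{d^n}, M^{d^n} \}$$ and $$\max\{ |z_j^n|,\ C_j(-\epsilon)^{d^n} M^{d^n} \} \ge C_j(-\epsilon)^{d^n} |z_j^0|^{d^n}.$$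
   Context: $K^- = \{z \in \mathbb{C}^k : \text{the sequence } F^{-n}(z),\ n \ge 0, \text{ is bounded}\}$. For $n \ge 0$ and $1 \le i \le k$, $z_i^n = \pi_i(F^n(z))$, where $\pi_i$ is the projection onto the $i$-th coordinate (so $z_i^0 = z_i$). For an integer $n$, $[n]$ denotes $n \bmod m$, with representative taken in $\{1,\dots,m\}$. For $1 \le i \le k$ and $1 \le l \le m-1$, $D^l_i = d_{[m-k+i]}\, d_{[m-k+i-1]} \cdots d_{[m-k+i-(l-1)]}$ (a product of $l$ factors).
   Formalization: The polynomials p_i are additionally assumed monic; for arbitrary leading coefficients the claim fails (e.g. k = m = 2, α_i = 2, p_i(w) = 10w², ε = 1/2), since the C_j(±ε) contain no leading coefficient. *)

theory Defs
  imports "HOL-Analysis.Analysis" "HOL-Computational_Algebra.Polynomial"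
begin

text \<open>
  Points of \<open>\<complex>\<^sup>k\<close> are functions on the index set \<open>{1..k}\<close>, extended by \<open>undefined\<close> so that
  equality of functions is equality of points.
\<close>

definition cspace :: "nat \<Rightarrow> (nat \<Rightarrow> complex) set" where
  "cspace k = (\<Pi>\<^sub>E i\<in>{1..k}. UNIV)"

definition shift_map :: "nat \<Rightarrow> complex \<Rightarrow> complex poly \<Rightarrow> (nat \<Rightarrow> complex) \<Rightarrow> (nat \<Rightarrow> complex)" where
  "shift_map k a p z = (\<lambda>i\<in>{1..k}. if i < k then z (i + 1) else a * z 1 + poly p (z k))"

text \<open>The composition \<open>F\<^sub>m \<circ> \<dots> \<circ> F\<^sub>1\<close>, where \<open>F\<^sub>1\<close> is applied first.\<close>

primrec shift_comp ::
  "nat \<Rightarrow> (nat \<Rightarrow> complex) \<Rightarrow> (nat \<Rightarrow> complex poly) \<Rightarrow> nat \<Rightarrow> (nat \<Rightarrow> complex) \<Rightarrow> (nat \<Rightarrow> complex)"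
where
  "shift_comp k \<alpha> p 0 = id"
| "shift_comp k \<alpha> p (Suc m) = shift_map k (\<alpha> (Suc m)) (p (Suc m)) \<circ> shift_comp k \<alpha> p m"

text \<open>
  The inverse is taken on \<open>cspace k\<close>, where the maps considered are bijective (shown below).
  Boundedness is stated with the Euclidean norm of \<open>\<complex>\<^sup>k\<close>; the library's metric on
  \<^typ>\<open>nat \<Rightarrow> complex\<close> is a bounded one and would make the condition void.
\<close>

definition K_minus :: "nat \<Rightarrow> ((nat \<Rightarrow> complex) \<Rightarrow> (nat \<Rightarrow> complex)) \<Rightarrow> (nat \<Rightarrow> complex) set" where
  "K_minus k F = {z \<in> cspace k.
     \<exists>B. \<forall>n. L2_set (\<lambda>i. cmod ((inv_into (cspace k) F ^^ n) z i)) {1..k} \<le> B}"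

text \<open>\<open>[n]\<close>: the representative of \<open>n mod m\<close> in \<open>{1..m}\<close>.\<close>

definition cyc_rep :: "nat \<Rightarrow> int \<Rightarrow> nat" where
  "cyc_rep m n = nat ((n - 1) mod int m) + 1"

text \<open>
  The factors of \<open>D\<^sup>l\<^sub>i\<close> have indices \<open>[m - k + i], \<dots>, [m - k + i - (l - 1)]\<close>; the integers in
  brackets may be negative.
\<close>

definition D_prod :: "nat \<Rightarrow> nat \<Rightarrow> (nat \<Rightarrow> nat) \<Rightarrow> nat \<Rightarrow> nat \<Rightarrow> nat" where
  "D_prod m k d l i = (\<Prod>s<l. d (cyc_rep m (int m - int k + int i - int s)))"

text \<open>The constant \<open>C\<^sub>j(e)\<close>, for \<open>e = \<epsilon>\<close> or \<open>e = - \<epsilon>\<close>, given through its logarithm.\<close>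

definition C_const :: "nat \<Rightarrow> nat \<Rightarrow> (nat \<Rightarrow> nat) \<Rightarrow> nat \<Rightarrow> real \<Rightarrow> real" where
  "C_const m k d j e = exp ((1 + (\<Sum>l=1..m-1. real (D_prod m k d l j))) * ln (1 + e))"

lemma bij_betw_shift_map:
  assumes "k \<ge> 2" and "a \<noteq> 0"
  shows "bij_betw (shift_map k a p) (cspace k) (cspace k)"
proof (rule bij_betw_byWitness[where
    f' = "\<lambda>w. \<lambda>i\<in>{1..k}. if i = 1 then (w k - poly p (w (k - 1))) / a else w (i - 1)"])
  show "\<forall>z\<in>cspace k. (\<lambda>i\<in>{1..k}. if i = 1 then (shift_map k a p z k
      - poly p (shift_map k a p z (k - 1))) / a else shift_map k a p z (i - 1)) = z"
    using assms by (auto simp: cspace_def shift_map_def fun_eq_iff PiE_iff extensional_def)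
  show "\<forall>w\<in>cspace k. shift_map k a p
      (\<lambda>i\<in>{1..k}. if i = 1 then (w k - poly p (w (k - 1))) / a else w (i - 1)) = w"
    using assms by (auto simp: cspace_def shift_map_def fun_eq_iff PiE_iff extensional_def)
qed (auto simp: cspace_def shift_map_def)

lemma bij_betw_shift_comp:
  assumes "k \<ge> 2" and "\<And>i. i \<in> {1..m} \<Longrightarrow> \<alpha> i \<noteq> 0"
  shows "bij_betw (shift_comp k \<alpha> p m) (cspace k) (cspace k)"
  using assms(2)
proof (induction m)
  case 0
  show ?case by (simp add: bij_betw_def)
next
  case (Suc m)
  have "bij_betw (shift_comp k \<alpha> p m) (cspace k) (cspace k)"
    by (rule Suc.IH) (use Suc.prems in simp)
  then show ?case
    unfolding shift_comp.simps
    by (rule bij_betw_trans) (use Suc.prems in \<open>simp add: bij_betw_shift_map assms(1)\<close>)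
qed

end

theory Submission imports Defs begin

text \<open>
  The orbit of a point under the elementary maps, run cyclically in both directions, is one scalar
  sequence \<open>x\<close> over the integers with \<open>x(t + k) = \<alpha>\<^sub>i x(t) + p\<^sub>i(x(t + k - 1))\<close>, \<open>i = [t]\<close>, and
  \<open>z\<^sub>j\<^sup>n = x(n m + j)\<close>; membership in \<open>K\<^sup>-\<close> bounds \<open>x\<close> on the integers \<open>t \<le> 0\<close>
  (\<open>K_minus_scalar_orbit\<close>).

  Take \<open>M\<close> so large that \<open>p\<^sub>i(w)\<close> dominates for \<open>\<bar>w\<bar> \<ge> M\<close>. If \<open>\<bar>x(t)\<bar> \<ge> M\<close> and
  \<open>\<bar>x(t + 1)\<bar> \<le> \<bar>x(t)\<bar>\<close>, then solving the recursion for its oldest entry gives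
  \<open>\<bar>x(t + 1 - k)\<bar> \<ge> 2 \<bar>x(t)\<bar>\<close>, and repeating this backwards contradicts boundedness. Hence
  \<open>\<bar>x\<bar>\<close> strictly increases wherever it is at least \<open>M\<close> (\<open>backward_bounded_increases\<close>).

  This has two consequences. The perturbation \<open>\<alpha>\<^sub>i x(t + 1 - k)\<close> is at most linear in
  \<open>max(\<bar>x(t)\<bar>, M)\<close>, so that, with \<open>i = [t + 1 - k]\<close>,
  \<open>\<bar>x(t + 1) - x(t)\<^bsup>d\<^sub>i\<^esup>\<bar> \<le> \<epsilon> max(\<bar>x(t)\<bar>, M)\<^bsup>d\<^sub>i\<^esup>\<close>; and once \<open>\<bar>x\<bar>\<close> has reached
  \<open>M\<close> it stays above it, so the lower estimate can be iterated as well. Composing \<open>m\<close> steps from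
  \<open>x(n m + j)\<close> to \<open>x((n + 1) m + j)\<close> raises to the power \<open>d\<close> and collects exactly the factor
  \<open>C\<^sub>j(\<plusminus>\<epsilon>)\<close> (\<open>power_iterate_upper\<close>, \<open>power_iterate_lower\<close>, \<open>C_const_eq_power\<close>). Composing \<open>n\<close> such
  blocks by the same two lemmas gives this factor to the power \<open>1 + d + \<dots> + d\<^bsup>n-1\<^esup> \<le> d\<^bsup>n\<^esup>\<close>, and
  \<open>C\<^sub>j(-\<epsilon>) \<le> 1 \<le> C\<^sub>j(\<epsilon>)\<close>.
\<close>

section \<open>Growth of one step for large moduli\<close>

lemma monic_poly_dominated_by_leading_term:
  fixes p :: "complex poly"
  assumes "lead_coeff p = 1" and "degree p \<ge> 1" and "cmod w \<le> r" and "1 \<le> r"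
  shows "cmod (poly p w - w ^ degree p) \<le> (\<Sum>i<degree p. cmod (coeff p i)) * r ^ (degree p - 1)"
proof -
  have "poly p w = (\<Sum>i<degree p. coeff p i * w ^ i) + w ^ degree p"
    using assms(1) by (simp add: poly_altdef lessThan_Suc_atMost[symmetric])
  then have "cmod (poly p w - w ^ degree p) = cmod (\<Sum>i<degree p. coeff p i * w ^ i)"
    by simp
  also have "\<dots> \<le> (\<Sum>i<degree p. cmod (coeff p i) * r ^ (degree p - 1))"
  proof (rule sum_norm_le)
    fix i assume "i \<in> {..<degree p}"
    then have "cmod w ^ i \<le> r ^ (degree p - 1)"
      using assms(3,4) by (intro order_trans[OF power_mono power_increasing]) auto
    then show "cmod (coeff p i * w ^ i) \<le> cmod (coeff p i) * r ^ (degree p - 1)"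
      by (simp add: norm_mult norm_power mult_left_mono)
  qed
  finally show ?thesis
    by (simp add: sum_distrib_right)
qed

text \<open>
  One step turns \<open>w\<close> into \<open>a u + p(w)\<close>, where \<open>u\<close> is the oldest coordinate. As \<open>deg p \<ge> 2\<close>, even
  the linear term in \<open>u\<close> is of lower order when \<open>\<bar>u\<bar>\<close> is comparable to \<open>\<bar>w\<bar>\<close>.
\<close>
lemma eventually_step_near_leading_power:
  fixes p :: "complex poly" and a :: complex
  assumes "lead_coeff p = 1" and "degree p \<ge> 2" and "\<epsilon> > 0"
  shows "\<forall>\<^sub>F r in at_top. \<forall>w u. cmod w \<le> r \<longrightarrow> cmod u \<le> r \<longrightarrow>
           cmod (a * u + poly p w - w ^ degree p) \<le> \<epsilon> * r ^ degree p"
proof -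
  define c where "c = (\<Sum>i<degree p. cmod (coeff p i))"
  show ?thesis
    using eventually_ge_at_top[of 1] eventually_ge_at_top[of "(c + cmod a) / \<epsilon>"]
  proof eventually_elim
    case (elim r)
    show ?case
    proof (intro allI impI)
      fix w u assume w: "cmod w \<le> r" and u: "cmod u \<le> r"
      have "r ^ 1 \<le> r ^ (degree p - 1)"
        using assms(2) elim by (intro power_increasing) auto
      then have u': "cmod u \<le> r ^ (degree p - 1)"
        using u by simp
      have "cmod (a * u + poly p w - w ^ degree p)
          \<le> cmod a * cmod u + cmod (poly p w - w ^ degree p)"
        using norm_triangle_ineq[of "a * u" "poly p w - w ^ degree p"]
        by (simp add: norm_mult algebra_simps)
      also have "\<dots> \<le> cmod a * r ^ (degree p - 1) + c * r ^ (degree p - 1)"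
        unfolding c_def using assms elim w u'
        by (intro add_mono mult_left_mono monic_poly_dominated_by_leading_term) auto
      also have "\<dots> = (c + cmod a) * r ^ (degree p - 1)"
        by (simp add: algebra_simps)
      also have "\<dots> \<le> (\<epsilon> * r) * r ^ (degree p - 1)"
        using elim assms(3) by (intro mult_right_mono) (auto simp: field_simps)
      also have "\<dots> = \<epsilon> * r ^ degree p"
        using assms(2) by (cases "degree p") auto
      finally show "cmod (a * u + poly p w - w ^ degree p) \<le> \<epsilon> * r ^ degree p" .
    qed
  qed
qed

text \<open>
  Read backwards: the oldest entry is recovered as \<open>u = (x - p(w)) / a\<close>, and a superlinear
  \<open>p(w)\<close> cannot be cancelled by an \<open>x\<close> of modulus at most \<open>\<bar>w\<bar>\<close>.
\<close>
lemma eventually_backward_doubling: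
  fixes p :: "complex poly" and a :: complex
  assumes "lead_coeff p = 1" and "degree p \<ge> 2" and "a \<noteq> 0"
  shows "\<forall>\<^sub>F r in at_top. \<forall>w u. cmod w = r \<longrightarrow> cmod (a * u + poly p w) \<le> r \<longrightarrow> 2 * r \<le> cmod u"
  using eventually_step_near_leading_power[OF assms(1,2) half_gt_zero[OF zero_less_one], of 0]
    eventually_ge_at_top[of "2 * (1 + 2 * cmod a)"] eventually_ge_at_top[of 1]
proof eventually_elim
  case (elim r)
  show ?case
  proof (intro allI impI)
    fix w u assume w: "cmod w = r" and x: "cmod (a * u + poly p w) \<le> r"
    have "cmod (poly p w - w ^ degree p) \<le> 1/2 * r ^ degree p"
      using elim(1)[rule_format, of w 0] w elim(3) by simp
    moreover have "cmod (w ^ degree p) = r ^ degree p"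
      using w by (simp add: norm_power)
    ultimately have "r ^ degree p / 2 \<le> cmod (poly p w)"
      using norm_triangle_ineq3[of "poly p w" "w ^ degree p"] by linarith
    moreover have "r ^ 2 \<le> r ^ degree p"
      using assms(2) elim by (intro power_increasing) auto
    ultimately have "r ^ 2 / 2 \<le> cmod (poly p w)"
      by linarith
    moreover have "(1 + 2 * cmod a) * r \<le> r ^ 2 / 2"
      using mult_right_mono[OF elim(2), of r] elim(3) by (simp add: power2_eq_square)
    moreover have "cmod (poly p w) \<le> cmod (a * u + poly p w) + cmod a * cmod u"
      using norm_triangle_ineq4[of "a * u + poly p w" "a * u"] by (simp add: norm_mult)
    ultimately have "cmod a * (2 * r) \<le> cmod a * cmod u"
      using x by (simp add: algebra_simps)
    then show "2 * r \<le> cmod u"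
      using assms(3) by simp
  qed
qed

section \<open>Backward bounded sequences grow past a threshold\<close>

text \<open>
  Failure to increase at a value \<open>\<ge> R\<close> forces twice that value at most \<open>k - 1\<close> steps earlier.
  Where the sequence is maximal on that stretch it again fails to increase, so failures of
  doubling size occur arbitrarily far in the past.
\<close>
lemma backward_bounded_increases:
  fixes y :: "int \<Rightarrow> real"
  assumes "k \<ge> 2" and "R > 0"
    and doubling: "\<And>t. R \<le> y t \<Longrightarrow> y (t + 1) \<le> y t \<Longrightarrow> 2 * y t \<le> y (t + 1 - int k)"
    and bounded: "\<And>t. t \<le> 0 \<Longrightarrow> y t \<le> B"
    and "R \<le> y t"
  shows "y t < y (t + 1)"
proof (rule ccontr)
  assume fails: "\<not> y t < y (t + 1)"
  have far: "\<exists>s \<le> t - int N. 2 ^ N * R \<le> y s \<and> y (s + 1) \<le> y s" for N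
  proof (induction N)
    case 0
    then show ?case using fails assms(5) by (intro exI[of _ t]) auto
  next
    case (Suc N)
    then obtain s where s: "s \<le> t - int N" "2 ^ N * R \<le> y s" "y (s + 1) \<le> y s"
      by blast
    have "1 * R \<le> 2 ^ N * R"
      using assms(2) by (intro mult_right_mono) auto
    then have large: "R \<le> y s"
      using s(2) by simp
    have first: "2 * y s \<le> y (s + 1 - int k)"
      using doubling[OF large s(3)] .
    define J where "J = {s + 1 - int k..s - 1}"
    have J: "finite J" "J \<noteq> {}" "s + 1 - int k \<in> J"
      using assms(1) by (auto simp: J_def)
    then have "Max (y ` J) \<in> y ` J"
      by (intro Max_in) auto
    then obtain q where q: "q \<in> J" "y q = Max (y ` J)"
      by auto
    then have qmax: "y i \<le> y q" if "i \<in> J" for i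
      using that J(1) by simp
    have twice: "2 * y s \<le> y q"
      using first qmax[OF J(3)] by linarith
    have "y (q + 1) \<le> y q"
    proof (cases "q = s - 1")
      case True
      then show ?thesis using twice large assms(2) by simp
    next
      case False
      then show ?thesis using q(1) by (intro qmax) (auto simp: J_def)
    qed
    moreover have "2 ^ Suc N * R \<le> y q"
      using twice s(2) by simp
    moreover have "q \<le> t - int (Suc N)"
      using q(1) s(1) by (auto simp: J_def)
    ultimately show ?case by blast
  qed
  obtain N0 where N0: "B / R < 2 ^ N0"
    using real_arch_pow[of 2 "B / R"] by auto
  \<comment> \<open>\<open>N \<ge> t\<close> puts the failure where \<open>B\<close> is a bound.\<close>
  define N where "N = max N0 (nat t)"
  have N_ge: "t \<le> int N"
    unfolding N_def by linarith
  obtain s where s: "s \<le> t - int N" "2 ^ N * R \<le> y s"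
    using far[of N] by blast
  have "B < 2 ^ N0 * R"
    using N0 assms(2) by (simp add: field_simps)
  also have "\<dots> \<le> 2 ^ N * R"
    using assms(2) by (intro mult_right_mono power_increasing) (auto simp: N_def)
  also have "\<dots> \<le> B"
    using s bounded[of s] N_ge by simp
  finally show False by simp
qed

lemma past_bounded_by_present:
  fixes y :: "int \<Rightarrow> real"
  assumes "\<And>t. R \<le> y t \<Longrightarrow> y t < y (t + 1)"
  shows "y (t - int n) \<le> max (y t) R"
proof (induction n)
  case (Suc n)
  have "y (t - int (Suc n)) \<le> max (y (t - int (Suc n) + 1)) R"
    using assms[of "t - int (Suc n)"] by (cases "R \<le> y (t - int (Suc n))") auto
  then show ?case
    using Suc by (simp add: algebra_simps)
qed simp

section \<open>Iterating power inequalities\<close>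

text \<open>
  The exponent of \<open>c\<close> after \<open>L\<close> steps \<open>v \<mapsto> c v\<^sup>e\<close>: one from the last step, and
  for each earlier step the product of the powers taken after it.
\<close>
definition accumulated_exponent :: "(nat \<Rightarrow> nat) \<Rightarrow> nat \<Rightarrow> nat" where
  "accumulated_exponent e L = (\<Sum>i<L. \<Prod>s<i. e (L - 1 - s))"

lemma accumulated_exponent_Suc:
  "accumulated_exponent e (Suc L) = 1 + e L * accumulated_exponent e L"
  unfolding accumulated_exponent_def
  by (simp add: sum.lessThan_Suc_shift prod.lessThan_Suc_shift sum_distrib_left
      del: sum.lessThan_Suc prod.lessThan_Suc)

lemma power_iterate_upper:
  fixes v :: "nat \<Rightarrow> real"
  assumes "c \<ge> 0" and "\<And>l. 0 \<le> v l" and "\<And>l. v (Suc l) \<le> c * v l ^ e l"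
  shows "v L \<le> c ^ accumulated_exponent e L * v 0 ^ (\<Prod>i<L. e i)"
proof (induction L)
  case (Suc L)
  have "v (Suc L) \<le> c * (c ^ accumulated_exponent e L * v 0 ^ (\<Prod>i<L. e i)) ^ e L"
    using assms(1,2) Suc by (intro order_trans[OF assms(3)] mult_left_mono power_mono) auto
  then show ?case
    by (simp add: accumulated_exponent_Suc power_mult_distrib power_mult power_add mult.commute
        flip: power_mult)
qed (simp add: accumulated_exponent_def)

lemma power_iterate_lower:
  fixes v :: "nat \<Rightarrow> real"
  assumes "c \<ge> 0" and "\<And>l. 0 \<le> v l" and "\<And>l. c * v l ^ e l \<le> v (Suc l)"
  shows "c ^ accumulated_exponent e L * v 0 ^ (\<Prod>i<L. e i) \<le> v L"
proof (induction L)
  case (Suc L)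
  have "c * (c ^ accumulated_exponent e L * v 0 ^ (\<Prod>i<L. e i)) ^ e L \<le> v (Suc L)"
    using assms(1,2) Suc by (intro order_trans[OF _ assms(3)] mult_left_mono power_mono) auto
  then show ?case
    by (simp add: accumulated_exponent_Suc power_mult_distrib power_mult power_add mult.commute
        flip: power_mult)
qed (simp add: accumulated_exponent_def)

lemma accumulated_exponent_const_less:
  assumes "q \<ge> 2"
  shows "accumulated_exponent (\<lambda>_. q) n < q ^ n"
proof (induction n)
  case (Suc n)
  have "1 + q * accumulated_exponent (\<lambda>_. q) n < q * (accumulated_exponent (\<lambda>_. q) n + 1)"
    using assms by simp
  also have "\<dots> \<le> q * q ^ n"
    using Suc by (intro mult_left_mono) auto
  finally show ?case by (simp add: accumulated_exponent_Suc)
qed (simp add: accumulated_exponent_def)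

section \<open>Cyclic indices\<close>

lemma cyc_rep_add_multiple [simp]: "cyc_rep m (int n * int m + t) = cyc_rep m t"
proof -
  have "int n * int m + t - 1 = t - 1 + int n * int m" by simp
  then show ?thesis unfolding cyc_rep_def by (simp only: mod_mult_self1)
qed

lemma cyc_rep_mem: "m > 0 \<Longrightarrow> cyc_rep m t \<in> {1..m}"
  unfolding cyc_rep_def by (simp add: nat_less_iff Suc_le_eq)

text \<open>Any \<open>m\<close> consecutive integers form a complete residue system.\<close>
lemma prod_cyc_rep_consecutive:
  fixes d :: "nat \<Rightarrow> nat"
  assumes "m > 0"
  shows "(\<Prod>l<m. d (cyc_rep m (t + int l))) = (\<Prod>i=1..m. d i)"
proof (rule prod.reindex_bij_betw)
  have inj: "inj_on (\<lambda>l. cyc_rep m (t + int l)) {..<m}"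
  proof (rule inj_onI)
    fix a b assume ab: "a \<in> {..<m}" "b \<in> {..<m}"
      and "cyc_rep m (t + int a) = cyc_rep m (t + int b)"
    then have "(t + int a - 1) mod int m = (t + int b - 1) mod int m"
      using assms by (simp add: cyc_rep_def eq_nat_nat_iff)
    then have "int m dvd int a - int b"
      by (simp add: mod_eq_dvd_iff)
    then show "a = b"
      using ab dvd_imp_le_int[of "int a - int b" "int m"] by (cases "a = b") auto
  qed
  moreover have "(\<lambda>l. cyc_rep m (t + int l)) ` {..<m} = {1..m}"
    using assms cyc_rep_mem by (intro card_subset_eq) (auto simp: card_image[OF inj])
  ultimately show "bij_betw (\<lambda>l. cyc_rep m (t + int l)) {..<m} {1..m}"
    by (simp add: bij_betw_def)
qed

text \<open>
  The step producing \<open>x(t + 1)\<close> has index \<open>[t + 1 - k]\<close>; with \<open>t = j + l\<close> and \<open>l = m - 1\<close> this is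
  the index \<open>[m - k + j]\<close> with which \<open>D\<^sub>j\<^sup>l\<close> starts.
\<close>
lemma C_const_eq_power:
  assumes "1 + e > 0" and "m > 0"
  shows "C_const m k d j e =
    (1 + e) ^ accumulated_exponent (\<lambda>l. d (cyc_rep m (int j + int l + 1 - int k))) m"
proof -
  have "accumulated_exponent (\<lambda>l. d (cyc_rep m (int j + int l + 1 - int k))) m
      = (\<Sum>l<m. D_prod m k d l j)"
    unfolding accumulated_exponent_def D_prod_def
    by (intro sum.cong prod.cong refl arg_cong[of _ _ d] arg_cong[of _ _ "cyc_rep m"]) auto
  also have "\<dots> = 1 + (\<Sum>l=1..m-1. D_prod m k d l j)"
  proof -
    have "{..<m} = insert 0 {1..m-1}" using assms(2) by auto
    then show ?thesis by (simp add: D_prod_def)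
  qed
  finally show ?thesis
    using assms(1) unfolding C_const_def
    by (simp add: exp_of_nat_mult del: of_nat_Suc of_nat_sum power_Suc
        flip: of_nat_sum of_nat_Suc)
qed

section \<open>The two-sided scalar orbit\<close>

text \<open>
  Membership in \<open>K\<^sup>-\<close> only controls the points \<open>F\<^bsup>-n\<^esup>(z)\<close>; this covers the intermediate points
  inside one application of \<open>F\<close>.
\<close>
lemma shift_comp_image_bounded:
  assumes "\<forall>w\<in>W. \<forall>i\<in>{1..k}. cmod (w i) \<le> B"
  shows "\<exists>B'. \<forall>r\<le>m. \<forall>w\<in>W. \<forall>i\<in>{1..k}. cmod (shift_comp k \<alpha> p r w i) \<le> B'"
proof (induction m)
  case 0
  then show ?case using assms by auto
next
  case (Suc m)
  then obtain B1 where B1: "\<And>r w i. r \<le> m \<Longrightarrow> w \<in> W \<Longrightarrow> i \<in> {1..k} \<Longrightarrow>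
      cmod (shift_comp k \<alpha> p r w i) \<le> B1"
    by blast
  have "compact (poly (p (Suc m)) ` cball 0 B1)"
    by (intro compact_continuous_image continuous_intros) auto
  then obtain B2 where B2: "\<And>v. cmod v \<le> B1 \<Longrightarrow> cmod (poly (p (Suc m)) v) \<le> B2"
    using compact_imp_bounded bounded_iff by (metis image_eqI mem_cball_0)
  define B3 where "B3 = max B1 (cmod (\<alpha> (Suc m)) * B1 + B2)"
  have "cmod (shift_comp k \<alpha> p r w i) \<le> B3"
    if "r \<le> Suc m" "w \<in> W" "i \<in> {1..k}" for r w i
  proof (cases "r = Suc m")
    case False
    then show ?thesis using B1[of r w i] that by (simp add: B3_def)
  next
    case r: True
    show ?thesis
    proof (cases "i < k")
      case True
      then show ?thesis
        using B1[of m w "i + 1"] that r by (simp add: shift_map_def B3_def)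
    next
      case False
      let ?v = "shift_comp k \<alpha> p m w"
      have "cmod (\<alpha> (Suc m) * ?v 1 + poly (p (Suc m)) (?v k)) \<le> cmod (\<alpha> (Suc m)) * B1 + B2"
        using B1[of m w 1] B1[of m w k] that
        by (intro norm_triangle_le add_mono) (auto simp: norm_mult mult_left_mono B2)
      then show ?thesis
        using that r False by (simp add: shift_map_def B3_def)
    qed
  qed
  then show ?case by blast
qed

text \<open>
  Each elementary map shifts the coordinates and creates one new number, so the whole orbit of a
  point under the elementary maps, run cyclically in both directions, is one scalar sequence
  of which every intermediate point is a window of length \<open>k\<close>.
\<close>
lemma K_minus_scalar_orbit:
  assumes "k \<ge> 2" and "m > 0" and "\<And>i. i \<in> {1..m} \<Longrightarrow> \<alpha> i \<noteq> 0"
    and F: "F = shift_comp k \<alpha> p m" and z: "z \<in> K_minus k F"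
  obtains x :: "int \<Rightarrow> complex" and B where
    "\<And>n j. j \<in> {1..k} \<Longrightarrow> x (int n * int m + int j) = (F ^^ n) z j"
    "\<And>t. x (t + int k) = \<alpha> (cyc_rep m t) * x t + poly (p (cyc_rep m t)) (x (t + int k - 1))"
    "\<And>t. t \<le> 0 \<Longrightarrow> cmod (x t) \<le> B"
proof -
  define H where "H = inv_into (cspace k) F"
  define G where "G = (\<lambda>n::int. if n \<ge> 0 then (F ^^ nat n) z else (H ^^ nat (- n)) z)"
  define P where "P = (\<lambda>s::int. shift_comp k \<alpha> p (nat (s mod int m)) (G (s div int m)))"
  define x where "x = (\<lambda>s. P (s - 1) 1)"
  have bij: "bij_betw F (cspace k) (cspace k)"
    unfolding F using assms(1,3) by (intro bij_betw_shift_comp) auto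
  have Hc: "(H ^^ n) z \<in> cspace k" for n
  proof (induction n)
    case 0
    then show ?case using z by (simp add: K_minus_def)
  next
    case (Suc n)
    then show ?case using bij_betwE[OF bij_betw_inv_into[OF bij]] by (simp add: H_def)
  qed
  have G_step: "G (n + 1) = F (G n)" for n
  proof (cases "n \<ge> 0")
    case True
    then show ?thesis by (simp add: G_def nat_add_distrib)
  next
    case False
    define q where "q = nat (- n - 1)"
    have n: "n = - int q - 1" using False by (simp add: q_def)
    have "F ((H ^^ Suc q) z) = (H ^^ q) z"
      using bij_betw_inv_into_right[OF bij Hc[of q]] by (simp add: H_def)
    moreover have "G n = (H ^^ Suc q) z"
      using n False by (simp add: G_def nat_add_distrib)
    moreover have "G (n + 1) = (H ^^ q) z"
      using n by (auto simp: G_def)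
    ultimately show ?thesis by simp
  qed
  have P_step: "P (s + 1) = shift_map k (\<alpha> (cyc_rep m (s + 1))) (p (cyc_rep m (s + 1))) (P s)" for s
  proof -
    define r where "r = nat (s mod int m)"
    have r: "s mod int m = int r" "r < m"
      using assms(2) by (auto simp: r_def nat_less_iff)
    have s: "s = int r + int m * (s div int m)"
      using mult_div_mod_eq[of "int m" s] r by simp
    have c: "cyc_rep m (s + 1) = Suc r"
      by (simp add: cyc_rep_def r_def)
    have "P (s + 1) = shift_comp k \<alpha> p (Suc r) (G (s div int m))"
    proof (cases "Suc r < m")
      case True
      have s1: "s + 1 = int (Suc r) + int m * (s div int m)" using s by simp
      have "(s + 1) mod int m = int (Suc r)" "(s + 1) div int m = s div int m"
        using True assms(2) by (subst s1, simp del: of_nat_Suc)+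
      then show ?thesis by (simp add: P_def del: of_nat_Suc)
    next
      case False
      then have m: "m = Suc r" using r by simp
      have s1: "s + 1 = int m * (s div int m + 1)"
        using s unfolding m by (simp add: algebra_simps)
      have "(s + 1) mod int m = 0" "(s + 1) div int m = s div int m + 1"
        using assms(2) by (subst s1, simp)+
      then show ?thesis using G_step F m by (simp add: P_def)
    qed
    then show ?thesis by (simp add: c P_def r_def)
  qed
  have window: "i \<in> {1..k} \<Longrightarrow> P s i = x (s + int i)" for s i
  proof (induction i arbitrary: s)
    case (Suc i)
    show ?case
    proof (cases "i = 0")
      case False
      then have "P s (Suc i) = P (s + 1) i"
        using Suc.prems by (simp add: P_step shift_map_def)
      then show ?thesis using Suc.IH[of "s + 1"] Suc.prems False by (simp add: add_ac)
    qed (simp add: x_def)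
  qed simp
  have coordinates: "x (int n * int m + int j) = (F ^^ n) z j" if "j \<in> {1..k}" for n j
    using window[OF that, of "int n * int m"] assms(2) by (simp add: P_def G_def)
  have recursion: "x (t + int k)
      = \<alpha> (cyc_rep m t) * x t + poly (p (cyc_rep m t)) (x (t + int k - 1))" for t
  proof -
    have "x (t + int k) = P t k"
      using window[of k t] assms(1) by simp
    also have "\<dots> = \<alpha> (cyc_rep m t) * P (t - 1) 1 + poly (p (cyc_rep m t)) (P (t - 1) k)"
      using P_step[of "t - 1"] assms(1) by (simp add: shift_map_def)
    finally show ?thesis
      using window[of k "t - 1"] window[of 1 "t - 1"] assms(1) by (simp add: algebra_simps)
  qed
  obtain B0 where B0: "\<And>n. L2_set (\<lambda>i. cmod ((H ^^ n) z i)) {1..k} \<le> B0"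
    using z by (auto simp: K_minus_def H_def)
  have "cmod ((H ^^ n) z i) \<le> B0" if "i \<in> {1..k}" for n i
    using member_le_L2_set[of "{1..k}" i "\<lambda>i. cmod ((H ^^ n) z i)"] that B0[of n] by simp
  then obtain B where B: "\<And>r n i. r \<le> m \<Longrightarrow> i \<in> {1..k} \<Longrightarrow>
      cmod (shift_comp k \<alpha> p r ((H ^^ n) z) i) \<le> B"
    using shift_comp_image_bounded[of "range (\<lambda>n. (H ^^ n) z)" k B0 m \<alpha> p] by blast
  have "cmod (x t) \<le> B" if "t \<le> 0" for t
  proof -
    have "(t - 1) div int m < 0"
      using that assms(2) by (subst pos_imp_zdiv_neg_iff) auto
    moreover have "nat ((t - 1) mod int m) \<le> m"
      using pos_mod_bound[of "int m" "t - 1"] assms(2) by linarith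
    ultimately show ?thesis
      using B assms(1) by (simp add: x_def P_def G_def)
  qed
  with coordinates recursion show thesis by (rule that)
qed

section \<open>Growth on the points with bounded backward orbit\<close>

theorem theorem1p3:
  fixes k m :: nat
    and \<alpha> :: "nat \<Rightarrow> complex"
    and p :: "nat \<Rightarrow> complex poly"
    and d :: "nat \<Rightarrow> nat"
    and F :: "(nat \<Rightarrow> complex) \<Rightarrow> (nat \<Rightarrow> complex)"
    and d_tot :: nat
    and \<epsilon> :: real
  assumes "k \<ge> 2" and "m \<ge> 2"
    and "\<And>i. i \<in> {1..m} \<Longrightarrow> \<alpha> i \<noteq> 0"
    and "\<And>i. i \<in> {1..m} \<Longrightarrow> degree (p i) = d i"
    and "\<And>i. i \<in> {1..m} \<Longrightarrow> d i \<ge> 2"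
    and monic: "\<And>i. i \<in> {1..m} \<Longrightarrow> lead_coeff (p i) = 1"
    and "F = shift_comp k \<alpha> p m"
    and "d_tot = (\<Prod>i=1..m. d i)"
    and "0 < \<epsilon>" and "\<epsilon> < 1"
  shows "\<exists>M>0. \<forall>z\<in>K_minus k F. \<forall>n. \<forall>j\<in>{2..k}.
      cmod ((F ^^ n) z j)
        \<le> C_const m k d j \<epsilon> ^ (d_tot ^ n) * max (cmod (z j) ^ (d_tot ^ n)) (M ^ (d_tot ^ n))
    \<and> max (cmod ((F ^^ n) z j)) (C_const m k d j (- \<epsilon>) ^ (d_tot ^ n) * M ^ (d_tot ^ n))
        \<ge> C_const m k d j (- \<epsilon>) ^ (d_tot ^ n) * cmod (z j) ^ (d_tot ^ n)"
proof -
  have "\<forall>i\<in>{1..m}. \<forall>\<^sub>F r in at_top. \<forall>w u. cmod w \<le> r \<longrightarrow> cmod u \<le> r \<longrightarrow>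
           cmod (\<alpha> i * u + poly (p i) w - w ^ d i) \<le> \<epsilon> * r ^ d i"
    using eventually_step_near_leading_power[OF monic _ \<open>0 < \<epsilon>\<close>] assms(4,5) by fastforce
  moreover have "\<forall>i\<in>{1..m}. \<forall>\<^sub>F r in at_top. \<forall>w u. cmod w = r \<longrightarrow>
           cmod (\<alpha> i * u + poly (p i) w) \<le> r \<longrightarrow> 2 * r \<le> cmod u"
    using eventually_backward_doubling[OF monic _ assms(3)] assms(4,5) by fastforce
  ultimately have "\<forall>\<^sub>F r in at_top. \<forall>i\<in>{1..m}.
      (\<forall>w u. cmod w \<le> r \<longrightarrow> cmod u \<le> r \<longrightarrow>
        cmod (\<alpha> i * u + poly (p i) w - w ^ d i) \<le> \<epsilon> * r ^ d i) \<and>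
      (\<forall>w u. cmod w = r \<longrightarrow> cmod (\<alpha> i * u + poly (p i) w) \<le> r \<longrightarrow> 2 * r \<le> cmod u)"
    by (intro eventually_ball_finite ballI eventually_conj) auto
  then obtain R0 where R0: "\<And>r i w u. R0 \<le> r \<Longrightarrow> i \<in> {1..m} \<Longrightarrow> cmod w \<le> r \<Longrightarrow> cmod u \<le> r \<Longrightarrow>
        cmod (\<alpha> i * u + poly (p i) w - w ^ d i) \<le> \<epsilon> * r ^ d i"
      "\<And>i w u. R0 \<le> cmod w \<Longrightarrow> i \<in> {1..m} \<Longrightarrow> cmod (\<alpha> i * u + poly (p i) w) \<le> cmod w \<Longrightarrow>
        2 * cmod w \<le> cmod u"
    unfolding eventually_at_top_linorder by blast
  define R where "R = max R0 1"
  have R: "R0 \<le> R" "1 \<le> R" by (auto simp: R_def)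
  have m0: "m > 0" using assms(2) by simp
  have d_tot: "d_tot \<ge> 2"
  proof -
    have "d 1 dvd d_tot" "d_tot > 0"
      using assms(2) order_less_le_trans[OF zero_less_numeral assms(5)] unfolding assms(8)
      by (auto intro!: dvd_prodI prod_pos)
    then show ?thesis using assms(5)[of 1] assms(2) dvd_imp_le[of "d 1" d_tot] by auto
  qed
  have "cmod ((F ^^ n) z j)
        \<le> C_const m k d j \<epsilon> ^ (d_tot ^ n) * max (cmod (z j) ^ (d_tot ^ n)) (R ^ (d_tot ^ n))
    \<and> C_const m k d j (- \<epsilon>) ^ (d_tot ^ n) * cmod (z j) ^ (d_tot ^ n)
        \<le> max (cmod ((F ^^ n) z j)) (C_const m k d j (- \<epsilon>) ^ (d_tot ^ n) * R ^ (d_tot ^ n))"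
    if z: "z \<in> K_minus k F" and j: "j \<in> {2..k}" for z n j
  proof -
    obtain x B where x: "\<And>n j. j \<in> {1..k} \<Longrightarrow> x (int n * int m + int j) = (F ^^ n) z j"
      and rec0: "\<And>t. x (t + int k)
          = \<alpha> (cyc_rep m t) * x t + poly (p (cyc_rep m t)) (x (t + int k - 1))"
      and bounded: "\<And>t. t \<le> 0 \<Longrightarrow> cmod (x t) \<le> B"
      using K_minus_scalar_orbit[OF assms(1) m0 assms(3) assms(7) z] by metis
    define idx where "idx = (\<lambda>t. cyc_rep m (t + 1 - int k))"
    have idx: "idx t \<in> {1..m}" for t
      unfolding idx_def by (rule cyc_rep_mem[OF m0])
    have rec: "x (t + 1) = \<alpha> (idx t) * x (t + 1 - int k) + poly (p (idx t)) (x t)" for t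
      using rec0[of "t + 1 - int k"] by (simp add: idx_def)
    have incr: "cmod (x t) < cmod (x (t + 1))" if "R \<le> cmod (x t)" for t
    proof (rule backward_bounded_increases[where y = "\<lambda>t. cmod (x t)", OF assms(1) _ _ bounded that])
      show "2 * cmod (x t) \<le> cmod (x (t + 1 - int k))"
        if "R \<le> cmod (x t)" "cmod (x (t + 1)) \<le> cmod (x t)" for t
        using that R0(2)[OF _ idx[of t], of "x t"] R unfolding rec by auto
    qed (use R in auto)
    have near: "cmod (x (t + 1) - x t ^ d (idx t)) \<le> \<epsilon> * max (cmod (x t)) R ^ d (idx t)" for t
      unfolding rec
    proof (rule R0(1)[OF _ idx])
      show "cmod (x (t + 1 - int k)) \<le> max (cmod (x t)) R"
        using past_bounded_by_present[of R "\<lambda>t. cmod (x t)" t "k - 1", OF incr] assms(1)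
        by (simp add: of_nat_diff algebra_simps)
    qed (use R in auto)
    define e where "e = (\<lambda>l. d (cyc_rep m (int j + int l + 1 - int k)))"
    have e: "d (idx (int n * int m + int j + int l)) = e l" for n l
      using cyc_rep_add_multiple[of m n "int j + int l + 1 - int k"]
      by (simp add: idx_def e_def algebra_simps)
    have prod_e: "(\<Prod>l<m. e l) = d_tot"
      using prod_cyc_rep_consecutive[OF m0, of d "int j + 1 - int k"] assms(8)
      by (simp add: e_def algebra_simps)
    have Cexp: "C_const m k d j \<epsilon> = (1 + \<epsilon>) ^ accumulated_exponent e m"
      "C_const m k d j (- \<epsilon>) = (1 - \<epsilon>) ^ accumulated_exponent e m"
      using C_const_eq_power[of \<epsilon> m k d j] C_const_eq_power[of "- \<epsilon>" m k d j] assms(9,10) m0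
      by (auto simp: e_def)
    have C: "1 \<le> C_const m k d j \<epsilon>" "0 \<le> C_const m k d j (- \<epsilon>)" "C_const m k d j (- \<epsilon>) \<le> 1"
      unfolding Cexp using assms(9,10) by (auto intro: one_le_power power_le_one)
    define a where "a = (\<lambda>n. cmod (x (int n * int m + int j)))"
    have a: "a n = cmod ((F ^^ n) z j)" for n
      using x[of j n] j by (simp add: a_def)
    have next_block: "int n * int m + int j + int m = int (Suc n) * int m + int j" for n
      by (simp add: algebra_simps)

    \<comment> \<open>Truncating at \<open>R \<ge> 1\<close> makes the one-step bound hold without a lower bound on \<open>\<bar>x\<bar>\<close>.\<close>
    have up: "max (a (Suc n)) R \<le> C_const m k d j \<epsilon> * max (a n) R ^ d_tot" for n
    proof -
      define v where "v = (\<lambda>l. max (cmod (x (int n * int m + int j + int l))) R)"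
      have "v (Suc l) \<le> (1 + \<epsilon>) * v l ^ e l" for l
      proof -
        define t where "t = int n * int m + int j + int l"
        have "cmod (x (t + 1)) \<le> cmod (x t ^ e l) + \<epsilon> * v l ^ e l"
          using near[of t] norm_triangle_sub[of "x (t + 1)" "x t ^ e l"]
          by (simp add: t_def e v_def)
        also have "cmod (x t ^ e l) \<le> v l ^ e l"
          by (simp add: norm_power power_mono v_def t_def)
        finally have "cmod (x (t + 1)) \<le> (1 + \<epsilon>) * v l ^ e l"
          by (simp add: algebra_simps)
        moreover have "R \<le> (1 + \<epsilon>) * v l ^ e l"
        proof -
          have "2 \<le> e l" using assms(5)[OF idx] e by metis
          then have "R \<le> R ^ e l" using R by (intro self_le_power) auto
          also have "\<dots> \<le> v l ^ e l" using R by (intro power_mono) (auto simp: v_def)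
          also have "\<dots> \<le> (1 + \<epsilon>) * v l ^ e l"
            using assms(9) R by (simp add: distrib_right v_def)
          finally show ?thesis .
        qed
        ultimately show ?thesis by (simp add: v_def t_def algebra_simps)
      qed
      then have "v m \<le> (1 + \<epsilon>) ^ accumulated_exponent e m * v 0 ^ (\<Prod>l<m. e l)"
        using assms(9) R by (intro power_iterate_upper) (auto simp: v_def)
      then show ?thesis
        unfolding prod_e Cexp v_def next_block a_def by simp
    qed
    have upper: "a n \<le> C_const m k d j \<epsilon> ^ (d_tot ^ n) * max (a 0 ^ (d_tot ^ n)) (R ^ (d_tot ^ n))"
    proof -
      have "a n \<le> max (a n) R" by simp
      also have "\<dots> \<le> C_const m k d j \<epsilon> ^ accumulated_exponent (\<lambda>_. d_tot) n
          * max (a 0) R ^ (\<Prod>i<n. d_tot)"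
        by (rule power_iterate_upper) (use C R up in auto)
      also have "\<dots> \<le> C_const m k d j \<epsilon> ^ (d_tot ^ n) * max (a 0) R ^ (d_tot ^ n)"
        using C R less_imp_le[OF accumulated_exponent_const_less[OF d_tot, of n]]
        by (auto intro!: mult_right_mono power_increasing)
      also have "max (a 0) R ^ (d_tot ^ n) = max (a 0 ^ (d_tot ^ n)) (R ^ (d_tot ^ n))"
      proof (cases "a 0 \<le> R")
        case True
        then show ?thesis by (simp add: a_def max_absorb2 power_mono)
      next
        case False
        then show ?thesis using R by (simp add: max_absorb1 power_mono)
      qed
      finally show ?thesis .
    qed

    have lower: "C_const m k d j (- \<epsilon>) ^ (d_tot ^ n) * a 0 ^ (d_tot ^ n) \<le> a n"
      if start: "R \<le> a 0"
    proof -
      have stays: "R \<le> cmod (x (int j + int l))" for l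
      proof (induction l)
        case 0
        then show ?case using start by (simp add: a_def)
      next
        case (Suc l)
        then show ?case using incr[of "int j + int l"] by (simp add: algebra_simps)
      qed
      have step: "(1 - \<epsilon>) * cmod (x (int n * int m + int j + int l)) ^ e l
          \<le> cmod (x (int n * int m + int j + int (Suc l)))" for n l
      proof -
        define t where "t = int n * int m + int j + int l"
        have "t = int j + int (n * m + l)" by (simp add: t_def)
        then have "R \<le> cmod (x t)" using stays by metis
        moreover have "d (idx t) = e l"
          unfolding t_def by (rule e)
        ultimately have "cmod (x (t + 1) - x t ^ e l) \<le> \<epsilon> * cmod (x t) ^ e l"
          using near[of t] by (simp add: max_absorb1)
        then have "cmod (x t) ^ e l \<le> cmod (x (t + 1)) + \<epsilon> * cmod (x t) ^ e l"
          using norm_triangle_ineq3[of "x (t + 1)" "x t ^ e l"]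
          by (simp add: norm_power)
        then have "(1 - \<epsilon>) * cmod (x t) ^ e l \<le> cmod (x (t + 1))"
          by (simp add: left_diff_distrib)
        then show ?thesis
          by (simp add: t_def add_ac)
      qed
      have block: "C_const m k d j (- \<epsilon>) * a n ^ d_tot \<le> a (Suc n)" for n
      proof -
        define v where "v = (\<lambda>l. cmod (x (int n * int m + int j + int l)))"
        have "(1 - \<epsilon>) ^ accumulated_exponent e m * v 0 ^ (\<Prod>l<m. e l) \<le> v m"
          using assms(10) step by (intro power_iterate_lower) (auto simp: v_def)
        then show ?thesis
          unfolding prod_e Cexp v_def next_block a_def by simp
      qed
      have "C_const m k d j (- \<epsilon>) ^ (d_tot ^ n) * a 0 ^ (d_tot ^ n)
          \<le> C_const m k d j (- \<epsilon>) ^ accumulated_exponent (\<lambda>_. d_tot) n * a 0 ^ (\<Prod>i<n. d_tot)"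
        using C less_imp_le[OF accumulated_exponent_const_less[OF d_tot, of n]]
        by (auto intro!: mult_right_mono power_decreasing simp: a_def)
      also have "\<dots> \<le> a n"
        by (rule power_iterate_lower) (use C block in \<open>auto simp: a_def\<close>)
      finally show ?thesis .
    qed
    have "C_const m k d j (- \<epsilon>) ^ (d_tot ^ n) * a 0 ^ (d_tot ^ n)
        \<le> max (a n) (C_const m k d j (- \<epsilon>) ^ (d_tot ^ n) * R ^ (d_tot ^ n))"
    proof (cases "R \<le> a 0")
      case True
      then show ?thesis using lower by simp
    next
      case False
      then have "C_const m k d j (- \<epsilon>) ^ (d_tot ^ n) * a 0 ^ (d_tot ^ n)
          \<le> C_const m k d j (- \<epsilon>) ^ (d_tot ^ n) * R ^ (d_tot ^ n)"
        using C by (intro mult_left_mono power_mono) (auto simp: a_def)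
      then show ?thesis by simp
    qed
    with upper show ?thesis
      using a[of 0] by (simp add: a)
  qed
  then show ?thesis
    using R by (intro exI[of _ R]) auto
qed

end
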